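(* Let $p\ge 1$, let $0<a_1<a_2<\cdots<a_p$ and $e_1,\dots,e_p\ge 1$ be integers, and let $Y$ be the Young diagram consisting of exactly $e_i$ rows of length $a_i$ for each $1\le i\le p$. Then $Y$ has an allocation if and only if $Y$ is Latin.
   Context: A Young diagram is a left-aligned array of cells with rows ordered by length, longest at the top. Latin: $Y$ is Latin if its cells can be filled with integers so that each row of length $l$ contains each of the numbers $1,\dots,l$ exactly once, and in each column all entries are distinct. Allocation: put $a_0=0$ and $b_i=a_i-a_{i-1}$ for $1\le i\le p$. An allocation for $Y$ is a collection of nonnegative integers $z_{ijk}$, indexed by triples with $1\le j\le i\le p$ and $1\le k\le i$, satisfying $$\sum_{k=1}^i z_{ijk}=e_ib_j\quad\text{for } 1\le j\le i\le p,$$ $$\sum_{j=1}^i z_{ijk}=e_ib_k\quad\text{for } 1\le k\le i\le p,$$ $$\sum_{i=\max(j,k)}^p z_{ijk}\le b_jb_k\quad\text{for } 1\le j,k\le p.$$ *)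

theory Defs
  imports Main
begin

text \<open>
  A Young diagram is represented by the list of its row lengths, from top to bottom.
  Rows and columns of cells are counted from 0.
\<close>

definition young_diagram :: "nat list \<Rightarrow> bool" where
  "young_diagram Y \<longleftrightarrow> sorted_wrt (\<ge>) Y \<and> 0 \<notin> set Y"

definition cells :: "nat list \<Rightarrow> (nat \<times> nat) set" where
  "cells Y = {(r, c). r < length Y \<and> c < Y ! r}"

definition latin_filling :: "nat list \<Rightarrow> (nat \<times> nat \<Rightarrow> int) \<Rightarrow> bool" where
  "latin_filling Y f \<longleftrightarrow>
     (\<forall>r < length Y. \<forall>v \<in> {1..int (Y ! r)}. \<exists>!c. (r, c) \<in> cells Y \<and> f (r, c) = v) \<and>
     (\<forall>c. inj_on (\<lambda>r. f (r, c)) {r. (r, c) \<in> cells Y})"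

definition latin :: "nat list \<Rightarrow> bool" where
  "latin Y \<longleftrightarrow> (\<exists>f. latin_filling Y f)"

definition consists_of_rows ::
    "nat list \<Rightarrow> nat \<Rightarrow> (nat \<Rightarrow> nat) \<Rightarrow> (nat \<Rightarrow> nat) \<Rightarrow> bool" where
  "consists_of_rows Y p a e \<longleftrightarrow>
     set Y \<subseteq> a ` {1..p} \<and> (\<forall>i \<in> {1..p}. count_list Y (a i) = e i)"

text \<open>
  The value of \<open>a\<close> at 0 is ignored and replaced by the convention $a_0 = 0$.  The truncated
  subtraction is exact for increasing \<open>a\<close>.
\<close>

definition step :: "(nat \<Rightarrow> nat) \<Rightarrow> nat \<Rightarrow> nat" where
  "step a i = a i - (if i = 1 then 0 else a (i - 1))"

text \<open>
  Only the values \<open>z i j k\<close> with $1 \le j \le i \le p$ and $1 \le k \le i$ occur in the constraints.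
\<close>

definition allocation ::
    "nat \<Rightarrow> (nat \<Rightarrow> nat) \<Rightarrow> (nat \<Rightarrow> nat) \<Rightarrow> (nat \<Rightarrow> nat \<Rightarrow> nat \<Rightarrow> nat) \<Rightarrow> bool" where
  "allocation p a e z \<longleftrightarrow>
     (\<forall>i \<in> {1..p}. \<forall>j \<in> {1..i}. (\<Sum>k = 1..i. z i j k) = e i * step a j) \<and>
     (\<forall>i \<in> {1..p}. \<forall>k \<in> {1..i}. (\<Sum>j = 1..i. z i j k) = e i * step a k) \<and>
     (\<forall>j \<in> {1..p}. \<forall>k \<in> {1..p}. (\<Sum>i = max j k..p. z i j k) \<le> step a j * step a k)"

end

theory Submission
  imports Defs
begin

text \<open>
  Group the rows of \<open>Y\<close> by length, and cut the columns and likewise the values into consecutive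
  blocks of sizes $b_1, \dots, b_p$, so that a row of length $a_i$ consists of the column blocks
  $1, \dots, i$ and uses the value blocks $1, \dots, i$.

  A Latin filling gives an allocation by counting: $z_{ijk}$ is the number of cells in a row of
  group $i$ and a column of block $j$ that carry a value of block $k$
  (\<open>allocation_if_latin\<close>).

  Conversely, read an allocation as a blurred filling, with $z_{ijk}$ tokens of which only the row
  group $i$, the column block $j$ and the value block $k$ are known, and sharpen the three
  coordinates one after the other (\<open>latin_if_tokens\<close>).  Each time the tokens are the edges of a
  bipartite multigraph whose two sides are the other two coordinates in their present resolution,
  and sharpening is an edge colouring.  The tokens of group $i$ join column blocks to value blocks
  and are coloured with the $e_i$ rows of the group; the tokens of column block $j$ join
  rows to value blocks and are coloured with the $b_j$ columns of the block; the tokens of value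
  block $k$ join rows to columns and are coloured with the $b_k$ values of the block.

  The colouring has to spread the edges evenly: if a vertex has degree at most $n d$ and there are
  $n$ colours, each colour should occur at most $d$ times at this vertex
  (\<open>bounded_edge_colouring\<close>).  Splitting every vertex into $d$ vertices of degree at most
  $n$ reduces this to the edge colouring theorem of Koenig, a bipartite multigraph with
  all degrees at most $n$ being properly $n$-edge-colourable (\<open>konig_edge_colouring\<close>).

  Only upper bounds pass through the three steps.  They end in the statement that no two tokens
  agree in two of their three coordinates.  Since there are as many tokens as cells, the tokens
  then occupy every cell, and every row contains every value that it should
  (\<open>latin_if_indexed\<close>).
\<close>

section \<open>Edge colourings of bipartite multigraphs\<close>

text \<open>
  A bipartite multigraph is a set \<open>E\<close> of edges with end point maps \<open>f\<close> and \<open>g\<close> into the two sides;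
  parallel edges are then distinct elements of \<open>E\<close>.  A colouring \<open>c\<close> is proper if
  \<open>e \<mapsto> (f e, c e)\<close> and \<open>e \<mapsto> (g e, c e)\<close> are injective on \<open>E\<close>.

  For a proper colouring in which \<open>v\<close> has no edge of colour \<open>\<beta>\<close>, the following set is the
  alternating path of colours \<open>\<alpha>\<close> and \<open>\<beta>\<close> that starts at \<open>v\<close>.  The rules traverse it away from
  \<open>v\<close>, so that the path enters each vertex on the \<open>f\<close> side through an edge of colour \<open>\<alpha>\<close>.
\<close>

inductive_set kempe_chain ::
    "'e set \<Rightarrow> ('e \<Rightarrow> 'a) \<Rightarrow> ('e \<Rightarrow> 'b) \<Rightarrow> ('e \<Rightarrow> 'c) \<Rightarrow> 'c \<Rightarrow> 'c \<Rightarrow> 'b \<Rightarrow> 'e set"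
  for E f g c \<alpha> \<beta> v where
  start: "\<lbrakk>e \<in> E; g e = v; c e = \<alpha>\<rbrakk> \<Longrightarrow> e \<in> kempe_chain E f g c \<alpha> \<beta> v"
| left: "\<lbrakk>e \<in> kempe_chain E f g c \<alpha> \<beta> v; c e = \<alpha>; e' \<in> E; f e' = f e; c e' = \<beta>\<rbrakk>
    \<Longrightarrow> e' \<in> kempe_chain E f g c \<alpha> \<beta> v"
| right: "\<lbrakk>e \<in> kempe_chain E f g c \<alpha> \<beta> v; c e = \<beta>; e' \<in> E; g e' = g e; c e' = \<alpha>\<rbrakk>
    \<Longrightarrow> e' \<in> kempe_chain E f g c \<alpha> \<beta> v"

text \<open>
  Swapping \<open>\<alpha>\<close> and \<open>\<beta>\<close> on \<open>S\<close> keeps a colouring proper at the \<open>f\<close> side because each vertex there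
  has either all or none of its edges of these two colours in \<open>S\<close>.
\<close>

lemma inj_on_swap_closed:
  assumes inj: "inj_on (\<lambda>e. (f e, c e)) E"
    and S: "\<And>e. e \<in> S \<Longrightarrow> c e \<in> {\<alpha>, \<beta>}"
    and closed: "\<And>e e'. \<lbrakk>e \<in> S; e' \<in> E; f e' = f e; c e' \<in> {\<alpha>, \<beta>}\<rbrakk> \<Longrightarrow> e' \<in> S"
  shows "inj_on (\<lambda>e. (f e, if e \<in> S then if c e = \<alpha> then \<beta> else \<alpha> else c e)) E"
    (is "inj_on (\<lambda>e. (f e, ?c e)) E")
proof (rule inj_onI)
  fix e e' assume e: "e \<in> E" "e' \<in> E" and "(f e, ?c e) = (f e', ?c e')"
  then have fe: "f e = f e'" and ce: "?c e = ?c e'" by auto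
  have "e \<in> S \<longleftrightarrow> e' \<in> S"
    using closed[of e e'] closed[of e' e] e fe ce by (auto split: if_splits)
  with ce S[of e] S[of e'] have "c e = c e'" by (auto split: if_splits)
  with inj e fe show "e = e'" by (auto dest: inj_onD)
qed

text \<open>
  The step in which bipartiteness is used.  If \<open>\<alpha>\<close> is free at \<open>u\<close> and \<open>\<beta>\<close> is free at \<open>v\<close>, swap
  the two colours along the chain from \<open>v\<close>.  This frees \<open>\<alpha>\<close> at \<open>v\<close>, and it does not disturb \<open>u\<close>:
  the chain enters vertices on the side of \<open>u\<close> only through edges of colour \<open>\<alpha>\<close>, and \<open>u\<close> has none.
\<close>

lemma kempe_swap:
  assumes "c ` E \<subseteq> C" and f: "inj_on (\<lambda>e. (f e, c e)) E" and g: "inj_on (\<lambda>e. (g e, c e)) E"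
    and "\<alpha> \<in> C" and "\<beta> \<in> C"
    and u: "\<And>e. \<lbrakk>e \<in> E; f e = u\<rbrakk> \<Longrightarrow> c e \<noteq> \<alpha>"
    and v: "\<And>e. \<lbrakk>e \<in> E; g e = v\<rbrakk> \<Longrightarrow> c e \<noteq> \<beta>"
  obtains c' where "c' ` E \<subseteq> C"
    and "inj_on (\<lambda>e. (f e, c' e)) E" and "inj_on (\<lambda>e. (g e, c' e)) E"
    and "\<And>e. \<lbrakk>e \<in> E; f e = u\<rbrakk> \<Longrightarrow> c' e \<noteq> \<alpha>" and "\<And>e. \<lbrakk>e \<in> E; g e = v\<rbrakk> \<Longrightarrow> c' e \<noteq> \<alpha>"
proof (cases "\<alpha> = \<beta>")
  case True
  then show ?thesis using that[of c] assms by blast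
next
  case False
  define S where "S = kempe_chain E f g c \<alpha> \<beta> v"
  define c' where "c' = (\<lambda>e. if e \<in> S then if c e = \<alpha> then \<beta> else \<alpha> else c e)"
  have SE: "e \<in> E" if "e \<in> S" for e
    using that unfolding S_def by cases
  have S: "c e \<in> {\<alpha>, \<beta>}" if "e \<in> S" for e
    using that unfolding S_def by cases auto
  have fS: "\<exists>d\<in>S. f d = f e \<and> c d = \<alpha>" if "e \<in> S" for e
    using that[unfolded S_def]
  proof cases
    case (left d)
    then show ?thesis unfolding S_def by metis
  qed (use that in blast)+
  have gS: "g e = v \<or> (\<exists>d\<in>S. g d = g e \<and> c d = \<beta>)" if "e \<in> S" for e
    using that[unfolded S_def]
  proof cases
    case (right d)
    then show ?thesis unfolding S_def by metis
  qed (use that in blast)+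
  \<comment> \<open>Properness makes the edge of colour \<open>\<alpha>\<close> (or \<open>\<beta>\<close>) at a vertex unique, so the rules of the
    chain, which lead in one direction only, already give closure in both directions.\<close>
  have f_closed: "e' \<in> S" if "e \<in> S" "e' \<in> E" "f e' = f e" "c e' \<in> {\<alpha>, \<beta>}" for e e'
  proof -
    obtain d where d: "d \<in> S" "f d = f e" "c d = \<alpha>" using fS \<open>e \<in> S\<close> by blast
    show ?thesis
    proof (cases "c e' = \<alpha>")
      case True
      then have "e' = d" using inj_onD[OF f, of e' d] SE d that by simp
      with d show ?thesis by simp
    next
      case False
      with that have "c e' = \<beta>" by simp
      with d that show ?thesis unfolding S_def by (simp add: kempe_chain.left)
    qed
  qed
  have g_closed: "e' \<in> S" if "e \<in> S" "e' \<in> E" "g e' = g e" "c e' \<in> {\<alpha>, \<beta>}" for e e'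
    using gS[OF \<open>e \<in> S\<close>]
  proof
    assume "g e = v"
    with that v have "c e' = \<alpha>" by auto
    with that \<open>g e = v\<close> show ?thesis unfolding S_def by (simp add: kempe_chain.start)
  next
    assume "\<exists>d\<in>S. g d = g e \<and> c d = \<beta>"
    then obtain d where d: "d \<in> S" "g d = g e" "c d = \<beta>" by blast
    show ?thesis
    proof (cases "c e' = \<beta>")
      case True
      then have "e' = d" using inj_onD[OF g, of e' d] SE d that by simp
      with d show ?thesis by simp
    next
      case False
      with that have "c e' = \<alpha>" by simp
      with d that show ?thesis unfolding S_def by (simp add: kempe_chain.right)
    qed
  qed
  show ?thesis
  proof
    show "c' ` E \<subseteq> C" using assms by (auto simp: c'_def)
    show "inj_on (\<lambda>e. (f e, c' e)) E"
      unfolding c'_def by (rule inj_on_swap_closed[OF f S f_closed])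
    show "inj_on (\<lambda>e. (g e, c' e)) E"
      unfolding c'_def by (rule inj_on_swap_closed[OF g S g_closed])
    show "c' e \<noteq> \<alpha>" if "e \<in> E" "f e = u" for e
      using that u[of e] u SE fS[of e] by (metis c'_def)
    show "c' e \<noteq> \<alpha>" if "e \<in> E" "g e = v" for e
    proof (cases "c e = \<alpha>")
      case True
      with that have "e \<in> S" unfolding S_def by (simp add: kempe_chain.start)
      with True False show ?thesis by (simp add: c'_def)
    next
      case c: False
      with v[OF that] S[of e] show ?thesis by (auto simp: c'_def)
    qed
  qed
qed

lemma free_colour:
  assumes "finite E" and "finite C" and "e0 \<notin> E"
    and "card {e \<in> insert e0 E. h e = h e0} \<le> card C"
  obtains \<alpha> where "\<alpha> \<in> C" and "\<And>e. \<lbrakk>e \<in> E; h e = h e0\<rbrakk> \<Longrightarrow> c e \<noteq> \<alpha>"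
proof -
  let ?F = "{e \<in> E. h e = h e0}"
  have "{e \<in> insert e0 E. h e = h e0} = insert e0 ?F" by auto
  with assms have "card ?F < card C" by simp
  then have "card (c ` ?F) < card C"
    using assms by (intro le_less_trans[OF card_image_le]) auto
  then have "\<not> C \<subseteq> c ` ?F"
    using card_mono[of "c ` ?F" C] \<open>finite E\<close> by auto
  then show ?thesis using that by blast
qed

lemma inj_on_extend_colouring:
  assumes "inj_on (\<lambda>e. (h e, c e)) E" and "e0 \<notin> E"
    and "\<And>e. \<lbrakk>e \<in> E; h e = h e0\<rbrakk> \<Longrightarrow> c e \<noteq> \<alpha>"
  shows "inj_on (\<lambda>e. (h e, (c(e0 := \<alpha>)) e)) (insert e0 E)"
proof (rule inj_onI)
  fix e e' assume *: "e \<in> insert e0 E" "e' \<in> insert e0 E"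
    "(h e, (c(e0 := \<alpha>)) e) = (h e', (c(e0 := \<alpha>)) e')"
  then show "e = e'"
    using assms(2,3) inj_onD[OF assms(1), of e e'] by (cases "e = e0"; cases "e' = e0") auto
qed

text \<open>
  Induction on the edges.  Without the new edge, each of its end points still has a free colour;
  the exchange along a Kempe chain makes one colour free at both.
\<close>

lemma konig_edge_colouring:
  assumes "finite E" and "finite C"
    and "\<And>x. card {e \<in> E. f e = x} \<le> card C" and "\<And>y. card {e \<in> E. g e = y} \<le> card C"
  shows "\<exists>c. c ` E \<subseteq> C \<and> inj_on (\<lambda>e. (f e, c e)) E \<and> inj_on (\<lambda>e. (g e, c e)) E"
  using assms(1,3,4)
proof (induction E rule: finite_induct)
  case empty
  show ?case by simp
next
  case (insert e0 E)
  have mono: "card {e \<in> E. P e} \<le> card {e \<in> insert e0 E. P e}" for P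
    using insert.hyps by (intro card_mono) auto
  have "card {e \<in> E. f e = x} \<le> card C" "card {e \<in> E. g e = y} \<le> card C" for x y
    using order_trans[OF mono insert.prems(1)] order_trans[OF mono insert.prems(2)] by this+
  then obtain c where
    c: "c ` E \<subseteq> C" "inj_on (\<lambda>e. (f e, c e)) E" "inj_on (\<lambda>e. (g e, c e)) E"
    using insert.IH by blast
  obtain \<alpha> where \<alpha>: "\<alpha> \<in> C" "\<And>e. \<lbrakk>e \<in> E; f e = f e0\<rbrakk> \<Longrightarrow> c e \<noteq> \<alpha>"
    using free_colour[OF insert.hyps(1) assms(2) insert.hyps(2) insert.prems(1)] by blast
  obtain \<beta> where \<beta>: "\<beta> \<in> C" "\<And>e. \<lbrakk>e \<in> E; g e = g e0\<rbrakk> \<Longrightarrow> c e \<noteq> \<beta>"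
    using free_colour[OF insert.hyps(1) assms(2) insert.hyps(2) insert.prems(2)] by blast
  obtain c' where c': "c' ` E \<subseteq> C" "inj_on (\<lambda>e. (f e, c' e)) E" "inj_on (\<lambda>e. (g e, c' e)) E"
    "\<And>e. \<lbrakk>e \<in> E; f e = f e0\<rbrakk> \<Longrightarrow> c' e \<noteq> \<alpha>" "\<And>e. \<lbrakk>e \<in> E; g e = g e0\<rbrakk> \<Longrightarrow> c' e \<noteq> \<alpha>"
    using kempe_swap[OF c \<alpha>(1) \<beta>(1) \<alpha>(2) \<beta>(2)] by blast
  have "(c'(e0 := \<alpha>)) ` insert e0 E \<subseteq> C" using c' \<alpha> by auto
  with inj_on_extend_colouring[OF c'(2) insert.hyps(2) c'(4)]
    inj_on_extend_colouring[OF c'(3) insert.hyps(2) c'(5)]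
  show ?case by blast
qed

text \<open>
  Splitting each vertex \<open>x\<close> into \<open>d x\<close> copies of degree at most \<open>n\<close>: number the edges at \<open>x\<close>
  from 0 and put consecutive runs of \<open>n\<close> of them on the same copy.
\<close>

lemma split_fibres:
  fixes f :: "'e \<Rightarrow> 'a" and d :: "'a \<Rightarrow> nat"
  assumes "finite E" and fib: "\<And>x. card {e \<in> E. f e = x} \<le> n * d x"
  obtains q :: "'e \<Rightarrow> nat" where "\<And>e. e \<in> E \<Longrightarrow> q e < d (f e)"
    and "\<And>y. card {e \<in> E. (f e, q e) = y} \<le> n"
proof -
  have "\<exists>\<iota>. bij_betw \<iota> {e \<in> E. f e = x} {0..<card {e \<in> E. f e = x}}" for x
    using \<open>finite E\<close> by (intro ex_bij_betw_finite_nat) auto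
  then obtain \<iota> where \<iota>: "\<And>x. bij_betw (\<iota> x) {e \<in> E. f e = x} {0..<card {e \<in> E. f e = x}}"
    by metis
  have less: "\<iota> (f e) e < n * d (f e)" if "e \<in> E" for e
    using bij_betwE[OF \<iota>[of "f e"]] that fib[of "f e"] by fastforce
  show ?thesis
  proof
    show "\<iota> (f e) e div n < d (f e)" if "e \<in> E" for e
      using less[OF that] by (simp add: less_mult_imp_div_less mult.commute)
    show "card {e \<in> E. (f e, \<iota> (f e) e div n) = y} \<le> n" for y
      \<comment> \<open>Division by \<open>n\<close> separates the copies only for positive \<open>n\<close>; for \<open>n = 0\<close> there are no edges.\<close>
    proof (cases "n = 0")
      case True
      with less have "E = {}" by auto
      then show ?thesis by simp
    next
      case False
      obtain x s where y: "y = (x, s)" by force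
      have "card {e \<in> E. (f e, \<iota> (f e) e div n) = y} \<le> card {s * n..<s * n + n}"
      proof (rule card_inj_on_le)
        show "inj_on (\<iota> x) {e \<in> E. (f e, \<iota> (f e) e div n) = y}"
          using \<iota>[of x] by (auto simp: bij_betw_def y intro: inj_on_subset)
        show "\<iota> x ` {e \<in> E. (f e, \<iota> (f e) e div n) = y} \<subseteq> {s * n..<s * n + n}"
          using False by (auto simp: y dividend_less_div_times add.commute)
      qed simp
      then show ?thesis by simp
    qed
  qed
qed

lemma card_fibre_if_inj_on_split:
  fixes q :: "'e \<Rightarrow> nat"
  assumes "\<And>e. e \<in> E \<Longrightarrow> q e < d (f e)" and "inj_on (\<lambda>e. ((f e, q e), c e)) E"
  shows "card {e \<in> E. f e = x \<and> c e = t} \<le> d x"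
proof -
  have "card {e \<in> E. f e = x \<and> c e = t} \<le> card {..<d x}"
    using assms by (intro card_inj_on_le[of q]) (auto simp: inj_on_def)
  then show ?thesis by simp
qed

lemma bounded_edge_colouring:
  fixes d d' :: "_ \<Rightarrow> nat"
  assumes "finite E" and "finite C"
    and "\<And>x. card {e \<in> E. f e = x} \<le> card C * d x"
    and "\<And>y. card {e \<in> E. g e = y} \<le> card C * d' y"
  shows "\<exists>c. (\<forall>e\<in>E. c e \<in> C) \<and>
    (\<forall>x t. card {e \<in> E. f e = x \<and> c e = t} \<le> d x) \<and>
    (\<forall>y t. card {e \<in> E. g e = y \<and> c e = t} \<le> d' y)"
proof -
  obtain q where q: "\<And>e. e \<in> E \<Longrightarrow> q e < d (f e)" "\<And>y. card {e \<in> E. (f e, q e) = y} \<le> card C"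
    using split_fibres[of E f "card C" d] assms by blast
  obtain q' where q': "\<And>e. e \<in> E \<Longrightarrow> q' e < d' (g e)" "\<And>y. card {e \<in> E. (g e, q' e) = y} \<le> card C"
    using split_fibres[of E g "card C" d'] assms by blast
  obtain c where "c ` E \<subseteq> C" "inj_on (\<lambda>e. ((f e, q e), c e)) E" "inj_on (\<lambda>e. ((g e, q' e), c e)) E"
    using konig_edge_colouring[OF assms(1,2) q(2) q'(2)] by blast
  note c = this
  have "card {e \<in> E. f e = x \<and> c e = t} \<le> d x" for x t
    using q(1) c(2) by (rule card_fibre_if_inj_on_split)
  moreover have "card {e \<in> E. g e = y \<and> c e = t} \<le> d' y" for y t
    using q'(1) c(3) by (rule card_fibre_if_inj_on_split)
  ultimately show ?thesis using c(1) by (intro exI[of _ c]) (simp add: image_subset_iff)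
qed

text \<open>
  The same for a disjoint union of multigraphs, where \<open>h\<close> tells the component of an edge and each
  component \<open>w\<close> has its own set \<open>C w\<close> of colours.
\<close>

lemma bounded_edge_colouring_parts:
  fixes d d' :: "_ \<Rightarrow> _ \<Rightarrow> nat"
  assumes "finite E" and "\<And>w. finite (C w)"
    and "\<And>w x. card {e \<in> E. h e = w \<and> f e = x} \<le> card (C w) * d w x"
    and "\<And>w y. card {e \<in> E. h e = w \<and> g e = y} \<le> card (C w) * d' w y"
  obtains c where "\<And>e. e \<in> E \<Longrightarrow> c e \<in> C (h e)"
    and "\<And>w x t. card {e \<in> E. h e = w \<and> f e = x \<and> c e = t} \<le> d w x"
    and "\<And>w y t. card {e \<in> E. h e = w \<and> g e = y \<and> c e = t} \<le> d' w y"
proof -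
  have part: "\<exists>c. (\<forall>e\<in>{e \<in> E. h e = w}. c e \<in> C w) \<and>
    (\<forall>x t. card {e \<in> {e \<in> E. h e = w}. f e = x \<and> c e = t} \<le> d w x) \<and>
    (\<forall>y t. card {e \<in> {e \<in> E. h e = w}. g e = y \<and> c e = t} \<le> d' w y)" (is "\<exists>c. ?P w c") for w
    using assms by (intro bounded_edge_colouring) auto
  have "\<exists>c. \<forall>w. ?P w (c w)" using part by (intro choice allI)
  then obtain c where "\<forall>w. ?P w (c w)" by blast
  then have c: "\<And>w e. \<lbrakk>e \<in> E; h e = w\<rbrakk> \<Longrightarrow> c w e \<in> C w"
    "\<And>w x t. card {e \<in> E. h e = w \<and> f e = x \<and> c w e = t} \<le> d w x"
    "\<And>w y t. card {e \<in> E. h e = w \<and> g e = y \<and> c w e = t} \<le> d' w y"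
    by (simp_all add: conj_assoc)
  show ?thesis
    using c by (intro that[of "\<lambda>e. c (h e) e"]) (simp_all cong: conj_cong)
qed

section \<open>Blocks of columns and groups of rows\<close>

text \<open>
  Columns are counted from 0.  The same blocks also serve for values, which are shifted to start
  from 0.
\<close>

definition block :: "(nat \<Rightarrow> nat) \<Rightarrow> nat \<Rightarrow> nat set" where
  "block a j = {(if j = 1 then 0 else a (j - 1))..<a j}"

lemma finite_block [simp]: "finite (block a j)"
  by (simp add: block_def)

lemma card_block [simp]: "card (block a j) = step a j"
  by (simp add: block_def step_def)

lemma UN_block:
  assumes mono: "strict_mono_on {1..p} a" and "i \<in> {1..p}"
  shows "(\<Union>j\<in>{1..i}. block a j) = {..<a i}"
proof -
  from \<open>i \<in> {1..p}\<close> have "1 \<le> i" "i \<le> p" by auto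
  then show ?thesis
  proof (induction i rule: dec_induct)
    case base
    then show ?case by (auto simp: block_def)
  next
    case (step i)
    then have "a i < a (Suc i)" by - (rule strict_mono_onD[OF mono], auto)
    moreover have "block a (Suc i) = {a i..<a (Suc i)}" using step.hyps by (simp add: block_def)
    moreover have "(\<Union>j\<in>{1..i}. block a j) = {..<a i}" using step by simp
    ultimately show ?case
      using ivl_disj_un_one(2)[of "a i" "a (Suc i)"] by (simp add: atLeastAtMostSuc_conv Un_commute)
  qed
qed

lemma block_unique:
  assumes mono: "strict_mono_on {1..p} a" and "j \<in> {1..p}" "j' \<in> {1..p}"
    and "x \<in> block a j" "x \<in> block a j'"
  shows "j = j'"
proof -
  have "\<not> j < j'" if "j \<in> {1..p}" "j' \<in> {1..p}" "x \<in> block a j" "x \<in> block a j'" for j j'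
  proof
    assume "j < j'"
    with that have "a j \<le> a (j' - 1)"
      by - (rule monotone_onD[OF strict_mono_on_imp_mono_on[OF mono]], auto)
    moreover have "a (j' - 1) \<le> x" using that \<open>j < j'\<close> by (simp add: block_def)
    moreover have "x < a j" using that by (simp add: block_def)
    ultimately show False by simp
  qed
  from this[of j j'] this[of j' j] assms show ?thesis by simp
qed

lemma sum_card_block:
  assumes mono: "strict_mono_on {1..p} a" and i: "i \<in> {1..p}" and "finite A"
  shows "(\<Sum>k=1..i. card {x \<in> A. \<kappa> x \<in> block a k}) = card {x \<in> A. \<kappa> x < a i}"
proof -
  have "{x \<in> A. \<kappa> x < a i} = (\<Union>k\<in>{1..i}. {x \<in> A. \<kappa> x \<in> block a k})"
    using UN_block[OF mono i] by blast
  moreover have "card \<dots> = (\<Sum>k=1..i. card {x \<in> A. \<kappa> x \<in> block a k})"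
  proof (rule card_UN_disjoint)
    show "\<forall>k\<in>{1..i}. finite {x \<in> A. \<kappa> x \<in> block a k}" using \<open>finite A\<close> by simp
    have "{1..i} \<subseteq> {1..p}" using i by auto
    then show "\<forall>k\<in>{1..i}. \<forall>k'\<in>{1..i}. k \<noteq> k' \<longrightarrow>
        {x \<in> A. \<kappa> x \<in> block a k} \<inter> {x \<in> A. \<kappa> x \<in> block a k'} = {}"
      using block_unique[OF mono] by blast
  qed simp
  ultimately show ?thesis by simp
qed

lemma block_subset:
  assumes "strict_mono_on {1..p} a" and "i \<in> {1..p}" and "j \<in> {1..i}"
  shows "block a j \<subseteq> {..<a i}"
  using UN_block[OF assms(1,2)] assms(3) by blast

lemma sum_step:
  assumes "strict_mono_on {1..p} a" and "i \<in> {1..p}"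
  shows "(\<Sum>j=1..i. step a j) = a i"
proof -
  have "{x \<in> {..<a i}. x \<in> block a j} = block a j" if "j \<in> {1..i}" for j
    using block_subset[OF assms that] by blast
  then have "(\<Sum>j=1..i. step a j) = (\<Sum>j=1..i. card {x \<in> {..<a i}. x \<in> block a j})"
    by (intro sum.cong refl) simp
  also have "\<dots> = a i"
    using sum_card_block[OF assms, of "{..<a i}" "\<lambda>x. x"] by simp
  finally show ?thesis .
qed

definition rows_of_length :: "nat list \<Rightarrow> nat \<Rightarrow> nat set" where
  "rows_of_length Y l = {r. r < length Y \<and> Y ! r = l}"

lemma finite_rows_of_length [simp]: "finite (rows_of_length Y l)"
  by (simp add: rows_of_length_def)

lemma card_rows_of_length [simp]: "card (rows_of_length Y l) = count_list Y l"
  unfolding rows_of_length_def count_list_eq_length_filter length_filter_conv_card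
  by (intro arg_cong[where f = card]) auto

lemma cells_eq_Sigma: "cells Y = (SIGMA r:{..<length Y}. {..<Y ! r})"
  by (auto simp: cells_def)

lemma finite_cells [simp]: "finite (cells Y)"
  by (simp add: cells_eq_Sigma)

lemma cells_of_length:
  "{x \<in> cells Y. Y ! fst x = l \<and> snd x \<in> B} = rows_of_length Y l \<times> ({..<l} \<inter> B)"
  by (auto simp: cells_def rows_of_length_def)

lemma card_cells:
  assumes "consists_of_rows Y p a e" and "inj_on a {1..p}"
  shows "card (cells Y) = (\<Sum>i=1..p. e i * a i)"
proof -
  have "cells Y = (\<Union>i\<in>{1..p}. rows_of_length Y (a i) \<times> {..<a i})"
  proof (intro equalityI subrelI)
    fix r c assume rc: "(r, c) \<in> cells Y"
    then have "Y ! r \<in> a ` {1..p}"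
      using assms(1) nth_mem[of r Y] by (auto simp: cells_def consists_of_rows_def)
    then obtain i where "Y ! r = a i" "i \<in> {1..p}" by (rule imageE)
    with rc show "(r, c) \<in> (\<Union>i\<in>{1..p}. rows_of_length Y (a i) \<times> {..<a i})"
      by (auto simp: cells_def rows_of_length_def)
  qed (auto simp: cells_def rows_of_length_def)
  moreover have "card \<dots> = (\<Sum>i=1..p. card (rows_of_length Y (a i) \<times> {..<a i}))"
    using inj_on_eq_iff[OF assms(2)]
    by (intro card_UN_disjoint) (auto simp: rows_of_length_def)
  ultimately show ?thesis
    using assms(1) by (simp add: consists_of_rows_def card_cartesian_product)
qed

section \<open>Latin fillings\<close>

lemma ex1_unique: "\<lbrakk>\<exists>!x. P x; P x; P y\<rbrakk> \<Longrightarrow> x = y"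
  by blast

text \<open>
  A form of the Latin property that puts columns and values on an equal footing.  With values counted from 0, the
  values that a row should contain are exactly the column indices of its cells, so a filling is
  correct on all rows if and only if it permutes the set of cells by
  $(r, c) \mapsto (r, \sigma(r, c))$.
\<close>

lemma latin_iff:
  "latin Y \<longleftrightarrow> (\<exists>\<sigma>. bij_betw (\<lambda>x. (fst x, \<sigma> x)) (cells Y) (cells Y) \<and>
     inj_on (\<lambda>x. (snd x, \<sigma> x)) (cells Y))"
proof
  assume "latin Y"
  then obtain f where f: "latin_filling Y f" unfolding latin_def by blast
  have row: "\<exists>!c. (r, c) \<in> cells Y \<and> f (r, c) = v"
    if "r < length Y" "v \<in> {1..int (Y ! r)}" for r v
    using f[unfolded latin_filling_def, THEN conjunct1, rule_format, OF that] .
  have col: "inj_on (\<lambda>r. f (r, c)) {r. (r, c) \<in> cells Y}" for c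
    using f[unfolded latin_filling_def, THEN conjunct2, rule_format] .
  \<comment> \<open>A filling is allowed to use any integers, but a row has no cells to spare: the \<open>l\<close> values
    that it must contain already fill it.\<close>
  have img: "(\<lambda>c. f (r, c)) ` {..<Y ! r} = {1..int (Y ! r)}" if r: "r < length Y" for r
  proof (rule sym, rule card_subset_eq)
    show sub: "{1..int (Y ! r)} \<subseteq> (\<lambda>c. f (r, c)) ` {..<Y ! r}"
    proof
      fix v assume v: "v \<in> {1..int (Y ! r)}"
      then obtain c where "(r, c) \<in> cells Y" "f (r, c) = v"
        using ex1_implies_ex[OF row[OF r v]] by blast
      then show "v \<in> (\<lambda>c. f (r, c)) ` {..<Y ! r}" by (auto simp: cells_def)
    qed
    have "card ((\<lambda>c. f (r, c)) ` {..<Y ! r}) \<le> Y ! r"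
      using card_image_le[of "{..<Y ! r}"] by simp
    with card_mono[OF _ sub] show "card {1..int (Y ! r)} = card ((\<lambda>c. f (r, c)) ` {..<Y ! r})"
      by simp
  qed simp
  have rng: "f (r, c) \<in> {1..int (Y ! r)}" if "(r, c) \<in> cells Y" for r c
    using img[of r] that by (auto simp: cells_def)
  define \<sigma> where "\<sigma> x = nat (f x - 1)" for x
  have f_eq: "f x = int (\<sigma> x) + 1" if "x \<in> cells Y" for x
    using that rng[of "fst x" "snd x"] by (simp add: \<sigma>_def)
  have "bij_betw (\<lambda>x. (fst x, \<sigma> x)) (cells Y) (cells Y)"
    unfolding bij_betw_def
  proof
    show inj: "inj_on (\<lambda>x. (fst x, \<sigma> x)) (cells Y)"
    proof (rule inj_onI, clarsimp)
      fix r c c' assume *: "(r, c) \<in> cells Y" "(r, c') \<in> cells Y" "\<sigma> (r, c) = \<sigma> (r, c')"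
      then have "f (r, c) = f (r, c')" by (simp add: f_eq)
      moreover have "r < length Y" using * by (simp add: cells_def)
      ultimately show "c = c'"
        using * by - (rule ex1_unique[OF row[OF _ rng[OF *(1)]]], auto)
    qed
    have "(\<lambda>x. (fst x, \<sigma> x)) ` cells Y \<subseteq> cells Y"
      using rng by (fastforce simp: \<sigma>_def cells_def)
    with inj show "(\<lambda>x. (fst x, \<sigma> x)) ` cells Y = cells Y"
      by (intro endo_inj_surj) auto
  qed
  moreover have "inj_on (\<lambda>x. (snd x, \<sigma> x)) (cells Y)"
  proof (rule inj_onI, clarsimp)
    fix r r' c assume "(r, c) \<in> cells Y" "(r', c) \<in> cells Y" "\<sigma> (r, c) = \<sigma> (r', c)"
    then show "r = r'" using inj_onD[OF col[of c], of r r'] by (simp add: f_eq)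
  qed
  ultimately show "\<exists>\<sigma>. bij_betw (\<lambda>x. (fst x, \<sigma> x)) (cells Y) (cells Y) \<and>
      inj_on (\<lambda>x. (snd x, \<sigma> x)) (cells Y)" by blast
next
  assume "\<exists>\<sigma>. bij_betw (\<lambda>x. (fst x, \<sigma> x)) (cells Y) (cells Y) \<and>
     inj_on (\<lambda>x. (snd x, \<sigma> x)) (cells Y)"
  then obtain \<sigma> where row: "bij_betw (\<lambda>x. (fst x, \<sigma> x)) (cells Y) (cells Y)"
    and col: "inj_on (\<lambda>x. (snd x, \<sigma> x)) (cells Y)" by blast
  have "\<exists>!c. (r, c) \<in> cells Y \<and> int (\<sigma> (r, c)) + 1 = v"
    if "r < length Y" "v \<in> {1..int (Y ! r)}" for r v
  proof -
    have "(r, nat (v - 1)) \<in> cells Y" using that by (auto simp: cells_def)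
    then have "(r, nat (v - 1)) \<in> (\<lambda>x. (fst x, \<sigma> x)) ` cells Y"
      by (simp only: bij_betw_imp_surj_on[OF row])
    then obtain x where "(r, nat (v - 1)) = (fst x, \<sigma> x)" "x \<in> cells Y" by (rule imageE)
    then have x: "x \<in> cells Y" "fst x = r" "\<sigma> x = nat (v - 1)" by simp_all
    show ?thesis
    proof (rule ex1I[of _ "snd x"])
      show "(r, snd x) \<in> cells Y \<and> int (\<sigma> (r, snd x)) + 1 = v" using x that by auto
      fix c assume c: "(r, c) \<in> cells Y \<and> int (\<sigma> (r, c)) + 1 = v"
      then have "(r, c) = x"
        using x by - (rule inj_onD[OF bij_betw_imp_inj_on[OF row]], auto)
      then show "c = snd x" by auto
    qed
  qed
  moreover have "inj_on (\<lambda>r. int (\<sigma> (r, c)) + 1) {r. (r, c) \<in> cells Y}" for c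
    using col by (fastforce simp: inj_on_def)
  ultimately show "latin Y"
    unfolding latin_def latin_filling_def
    by (intro exI[of _ "\<lambda>x. int (\<sigma> x) + 1"]) auto
qed

text \<open>
  A filling may be given by triples (row, column, value), indexed here by the elements of \<open>E\<close>.
\<close>

lemma latin_if_indexed:
  assumes \<rho>\<gamma>: "bij_betw (\<lambda>e. (\<rho> e, \<gamma> e)) E (cells Y)"
    and \<rho>\<sigma>: "bij_betw (\<lambda>e. (\<rho> e, \<sigma> e)) E (cells Y)"
    and \<gamma>\<sigma>: "inj_on (\<lambda>e. (\<gamma> e, \<sigma> e)) E"
  shows "latin Y"
proof -
  define \<iota> where "\<iota> = inv_into E (\<lambda>e. (\<rho> e, \<gamma> e))"
  have \<iota>: "bij_betw \<iota> (cells Y) E"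
    unfolding \<iota>_def using \<rho>\<gamma> by (rule bij_betw_inv_into)
  have "(\<rho> (\<iota> x), \<gamma> (\<iota> x)) = x" if "x \<in> cells Y" for x
    using bij_betw_inv_into_right[OF \<rho>\<gamma> that] by (simp add: \<iota>_def)
  then have eq: "\<rho> (\<iota> x) = fst x" "\<gamma> (\<iota> x) = snd x" if "x \<in> cells Y" for x
    using that by (metis fst_conv, metis snd_conv)
  have "bij_betw (\<lambda>x. (fst x, \<sigma> (\<iota> x))) (cells Y) (cells Y)"
    using bij_betw_trans[OF \<iota> \<rho>\<sigma>] by (simp add: o_def eq cong: bij_betw_cong)
  moreover have "inj_on (\<lambda>x. (snd x, \<sigma> (\<iota> x))) (cells Y)"
  proof (rule inj_onI)
    fix x y assume xy: "x \<in> cells Y" "y \<in> cells Y" "(snd x, \<sigma> (\<iota> x)) = (snd y, \<sigma> (\<iota> y))"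
    then have "\<iota> x = \<iota> y"
      using bij_betwE[OF \<iota>] by - (rule inj_onD[OF \<gamma>\<sigma>], simp_all add: eq)
    with xy show "x = y" by - (rule inj_onD[OF bij_betw_imp_inj_on[OF \<iota>]])
  qed
  ultimately show ?thesis unfolding latin_iff by (intro exI[of _ "\<lambda>x. \<sigma> (\<iota> x)"]) simp
qed

section \<open>From an allocation to a Latin filling\<close>

text \<open>
  The next two lemmas transfer bounds from single components to all edges: once a coordinate has
  been sharpened, it determines its group or block, so a condition that fixes the sharp coordinate
  selects edges from one component only.
\<close>

lemma card_le_if_determined:
  assumes "\<And>e e'. \<lbrakk>e \<in> E; e' \<in> E; P e; P e'\<rbrakk> \<Longrightarrow> h e = h e'"
    and "\<And>w. card {e \<in> E. h e = w \<and> P e} \<le> n"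
  shows "card {e \<in> E. P e} \<le> n"
proof (cases "\<exists>e\<in>E. P e")
  case True
  then obtain e0 where "e0 \<in> E" "P e0" by blast
  with assms(1) have "{e \<in> E. P e} = {e \<in> E. h e = h e0 \<and> P e}" by blast
  with assms(2) show ?thesis by simp
next
  case False
  then have "{e \<in> E. P e} = {}" by blast
  then show ?thesis by (simp only: card.empty zero_le)
qed

lemma inj_on_if_determined:
  assumes "finite E"
    and "\<And>e e'. \<lbrakk>e \<in> E; e' \<in> E; c e = c e'\<rbrakk> \<Longrightarrow> h e = h e'"
    and "\<And>w x t. card {e \<in> E. h e = w \<and> f e = x \<and> c e = t} \<le> 1"
  shows "inj_on (\<lambda>e. (f e, c e)) E"
proof (rule inj_onI)
  fix e e' assume e: "e \<in> E" "e' \<in> E" "(f e, c e) = (f e', c e')"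
  let ?F = "{d \<in> E. h d = h e \<and> f d = f e \<and> c d = c e}"
  have "e \<in> ?F" "e' \<in> ?F" using e assms(2)[of e' e] by auto
  moreover have "finite ?F" using \<open>finite E\<close> by simp
  ultimately show "e = e'" using assms(3)[of "h e" "f e" "c e"] card_le_Suc0_iff_eq[of ?F] by simp
qed

text \<open>
  Sharpening the tokens.  \<open>I\<close>, \<open>J\<close>, \<open>K\<close> are the row group, column block and value block of a token;
  \<open>\<rho>\<close>, \<open>\<gamma>\<close>, \<open>\<sigma>\<close> are the row, column and value found for it.  Each of the three bounds on pairs of
  blurred coordinates is needed by one of the first two colourings, and the colourings supply the
  bounds for their successors.
\<close>

lemma latin_if_tokens:
  assumes mono: "strict_mono_on {1..p} a" and "finite E"
    and I: "\<And>e. e \<in> E \<Longrightarrow> I e \<in> {1..p}"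
    and J: "\<And>e. e \<in> E \<Longrightarrow> J e \<in> {1..I e}" and K: "\<And>e. e \<in> E \<Longrightarrow> K e \<in> {1..I e}"
    and IJ: "\<And>i j. card {e \<in> E. I e = i \<and> J e = j} \<le> count_list Y (a i) * step a j"
    and IK: "\<And>i k. card {e \<in> E. I e = i \<and> K e = k} \<le> count_list Y (a i) * step a k"
    and JK: "\<And>j k. card {e \<in> E. J e = j \<and> K e = k} \<le> step a j * step a k"
    and card: "card E = card (cells Y)"
  shows "latin Y"
proof -
  have inj: "inj_on a {1..p}" using mono by (rule strict_mono_on_imp_inj_on)
  have JK_p: "J e \<in> {1..p}" "K e \<in> {1..p}" if "e \<in> E" for e
    using I[OF that] J[OF that] K[OF that] by auto
  obtain \<rho> where \<rho>: "\<And>e. e \<in> E \<Longrightarrow> \<rho> e \<in> rows_of_length Y (a (I e))"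
    and \<rho>J: "\<And>i j r. card {e \<in> E. I e = i \<and> J e = j \<and> \<rho> e = r} \<le> step a j"
    and \<rho>K: "\<And>i k r. card {e \<in> E. I e = i \<and> K e = k \<and> \<rho> e = r} \<le> step a k"
  proof (rule bounded_edge_colouring_parts[of E "\<lambda>i. rows_of_length Y (a i)" I J "\<lambda>i j. step a j"
        K "\<lambda>i k. step a k"])
    show "card {e \<in> E. I e = i \<and> J e = j} \<le> card (rows_of_length Y (a i)) * step a j" for i j
      using IJ by simp
    show "card {e \<in> E. I e = i \<and> K e = k} \<le> card (rows_of_length Y (a i)) * step a k" for i k
      using IK by simp
  qed (rule \<open>finite E\<close>, rule finite_rows_of_length, rule that)
  have I_eq: "I e = I e'" if "e \<in> E" "e' \<in> E" "\<rho> e = \<rho> e'" for e e'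
  proof -
    have "a (I e) = a (I e')"
      using \<rho>[OF that(1)] \<rho>[OF that(2)] that(3) by (simp add: rows_of_length_def)
    then show ?thesis using I[OF that(1)] I[OF that(2)] by (rule inj_onD[OF inj])
  qed
  have J\<rho>: "card {e \<in> E. J e = j \<and> \<rho> e = r} \<le> step a j" for j r
    by (rule card_le_if_determined[where h = I, OF _ \<rho>J]) (auto intro: I_eq)
  have K\<rho>: "card {e \<in> E. K e = k \<and> \<rho> e = r} \<le> step a k" for k r
    by (rule card_le_if_determined[where h = I, OF _ \<rho>K]) (auto intro: I_eq)
  obtain \<gamma> where \<gamma>: "\<And>e. e \<in> E \<Longrightarrow> \<gamma> e \<in> block a (J e)"
    and \<gamma>\<rho>: "\<And>j r c. card {e \<in> E. J e = j \<and> \<rho> e = r \<and> \<gamma> e = c} \<le> 1"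
    and \<gamma>K: "\<And>j k c. card {e \<in> E. J e = j \<and> K e = k \<and> \<gamma> e = c} \<le> step a k"
  proof (rule bounded_edge_colouring_parts[of E "block a" J \<rho> "\<lambda>_ _. 1" K "\<lambda>j k. step a k"])
    show "card {e \<in> E. J e = j \<and> \<rho> e = r} \<le> card (block a j) * 1" for j r
      using J\<rho> by simp
    show "card {e \<in> E. J e = j \<and> K e = k} \<le> card (block a j) * step a k" for j k
      using JK by simp
  qed (rule \<open>finite E\<close>, rule finite_block, rule that)
  have J_eq: "J e = J e'" if "e \<in> E" "e' \<in> E" "\<gamma> e = \<gamma> e'" for e e'
    using block_unique[OF mono JK_p(1)[OF that(1)] JK_p(1)[OF that(2)]]
      \<gamma>[OF that(1)] \<gamma>[OF that(2)] that(3) by simp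
  have K\<gamma>: "card {e \<in> E. K e = k \<and> \<gamma> e = c} \<le> step a k" for k c
    by (rule card_le_if_determined[where h = J, OF _ \<gamma>K]) (auto intro: J_eq)
  obtain \<sigma> where \<sigma>: "\<And>e. e \<in> E \<Longrightarrow> \<sigma> e \<in> block a (K e)"
    and \<sigma>\<rho>: "\<And>k r s. card {e \<in> E. K e = k \<and> \<rho> e = r \<and> \<sigma> e = s} \<le> 1"
    and \<sigma>\<gamma>: "\<And>k c s. card {e \<in> E. K e = k \<and> \<gamma> e = c \<and> \<sigma> e = s} \<le> 1"
  proof (rule bounded_edge_colouring_parts[of E "block a" K \<rho> "\<lambda>_ _. 1" \<gamma> "\<lambda>_ _. 1"])
    show "card {e \<in> E. K e = k \<and> \<rho> e = r} \<le> card (block a k) * 1" for k r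
      using K\<rho> by simp
    show "card {e \<in> E. K e = k \<and> \<gamma> e = c} \<le> card (block a k) * 1" for k c
      using K\<gamma> by simp
  qed (rule \<open>finite E\<close>, rule finite_block, rule that)
  have K_eq: "K e = K e'" if "e \<in> E" "e' \<in> E" "\<sigma> e = \<sigma> e'" for e e'
    using block_unique[OF mono JK_p(2)[OF that(1)] JK_p(2)[OF that(2)]]
      \<sigma>[OF that(1)] \<sigma>[OF that(2)] that(3) by simp
  \<comment> \<open>Columns and values play the same role here: a token of group \<open>i\<close> lies in one of the blocks
    \<open>1, \<dots>, i\<close>, hence below \<open>a i\<close>, and an injection between finite sets of equal size is onto.\<close>
  have bij: "bij_betw (\<lambda>e. (\<rho> e, \<kappa> e)) E (cells Y)"
    if L: "\<And>e. e \<in> E \<Longrightarrow> L e \<in> {1..I e}" and \<kappa>: "\<And>e. e \<in> E \<Longrightarrow> \<kappa> e \<in> block a (L e)"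
      and \<kappa>_inj: "inj_on (\<lambda>e. (\<rho> e, \<kappa> e)) E" for \<kappa> L
  proof -
    have "(\<rho> e, \<kappa> e) \<in> cells Y" if "e \<in> E" for e
      using \<rho>[OF that] \<kappa>[OF that] block_subset[OF mono I[OF that] L[OF that]]
      by (auto simp: cells_def rows_of_length_def)
    then have "(\<lambda>e. (\<rho> e, \<kappa> e)) ` E = cells Y"
      using card_image[OF \<kappa>_inj] card by (intro card_subset_eq) auto
    with \<kappa>_inj show ?thesis by (simp add: bij_betw_def)
  qed
  show ?thesis
  proof (rule latin_if_indexed)
    show "bij_betw (\<lambda>e. (\<rho> e, \<gamma> e)) E (cells Y)"
      using J \<gamma> inj_on_if_determined[OF \<open>finite E\<close> J_eq \<gamma>\<rho>] by (rule bij)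
    show "bij_betw (\<lambda>e. (\<rho> e, \<sigma> e)) E (cells Y)"
      using K \<sigma> inj_on_if_determined[OF \<open>finite E\<close> K_eq \<sigma>\<rho>] by (rule bij)
    show "inj_on (\<lambda>e. (\<gamma> e, \<sigma> e)) E"
      using \<open>finite E\<close> K_eq \<sigma>\<gamma> by (rule inj_on_if_determined)
  qed
qed

lemma card_le_sum_fibres:
  fixes n :: "'l \<Rightarrow> nat"
  assumes "F \<subseteq> h ` (SIGMA l:L. {..<n l})" and "finite L"
  shows "card F \<le> (\<Sum>l\<in>L. n l)"
  using surj_card_le[OF _ assms(1)] assms(2) by simp

lemma latin_if_allocation:
  assumes mono: "strict_mono_on {1..p} a" and rows: "consists_of_rows Y p a e"
    and z: "allocation p a e z"
  shows "latin Y"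
proof -
  \<comment> \<open>The fourth component numbers the \<open>z i j k\<close> tokens with the same blurred coordinates.\<close>
  define E where "E = (SIGMA i:{1..p}. SIGMA j:{1..i}. SIGMA k:{1..i}. {..<z i j k})"
  define I J K where "I = (fst :: nat \<times> nat \<times> nat \<times> nat \<Rightarrow> nat)"
    and "J = (\<lambda>x :: nat \<times> nat \<times> nat \<times> nat. fst (snd x))"
    and "K = (\<lambda>x :: nat \<times> nat \<times> nat \<times> nat. fst (snd (snd x)))"
  note defs = E_def I_def J_def K_def
  have e: "count_list Y (a i) = e i" if "i \<in> {1..p}" for i
    using rows that by (simp add: consists_of_rows_def)
  have zk: "(\<Sum>k=1..i. z i j k) = e i * step a j" if "i \<in> {1..p}" "j \<in> {1..i}" for i j
    using z that by (simp add: allocation_def)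
  have zj: "(\<Sum>j=1..i. z i j k) = e i * step a k" if "i \<in> {1..p}" "k \<in> {1..i}" for i k
    using z that by (simp add: allocation_def)
  have zi: "(\<Sum>i=max j k..p. z i j k) \<le> step a j * step a k" if "j \<in> {1..p}" "k \<in> {1..p}" for j k
    using z that by (simp add: allocation_def)
  show ?thesis
  proof (rule latin_if_tokens[OF mono])
    show "finite E" by (simp add: E_def)
    show "I x \<in> {1..p}" "J x \<in> {1..I x}" "K x \<in> {1..I x}" if "x \<in> E" for x
      using that by (auto simp: defs)
    show "card {x \<in> E. I x = i \<and> J x = j} \<le> count_list Y (a i) * step a j" for i j
    proof (cases "i \<in> {1..p} \<and> j \<in> {1..i}")
      case True
      have "card {x \<in> E. I x = i \<and> J x = j} \<le> (\<Sum>k=1..i. z i j k)"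
        by (rule card_le_sum_fibres[where h = "\<lambda>(k, t). (i, j, k, t)"]) (auto simp: defs image_iff)
      with True zk e show ?thesis by simp
    next
      case False
      then have "{x \<in> E. I x = i \<and> J x = j} = {}" by (auto simp: defs)
      then show ?thesis by (simp only: card.empty zero_le)
    qed
    show "card {x \<in> E. I x = i \<and> K x = k} \<le> count_list Y (a i) * step a k" for i k
    proof (cases "i \<in> {1..p} \<and> k \<in> {1..i}")
      case True
      have "card {x \<in> E. I x = i \<and> K x = k} \<le> (\<Sum>j=1..i. z i j k)"
        by (rule card_le_sum_fibres[where h = "\<lambda>(j, t). (i, j, k, t)"]) (auto simp: defs image_iff)
      with True zj e show ?thesis by simp
    next
      case False
      then have "{x \<in> E. I x = i \<and> K x = k} = {}" by (auto simp: defs)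
      then show ?thesis by (simp only: card.empty zero_le)
    qed
    show "card {x \<in> E. J x = j \<and> K x = k} \<le> step a j * step a k" for j k
    proof (cases "j \<in> {1..p} \<and> k \<in> {1..p}")
      case True
      have "card {x \<in> E. J x = j \<and> K x = k} \<le> (\<Sum>i=max j k..p. z i j k)"
        by (rule card_le_sum_fibres[where h = "\<lambda>(i, t). (i, j, k, t)"]) (auto simp: defs image_iff)
      with True zi[of j k] show ?thesis by simp
    next
      case False
      then have "{x \<in> E. J x = j \<and> K x = k} = {}" by (auto simp: defs)
      then show ?thesis by (simp only: card.empty zero_le)
    qed
    have "card E = (\<Sum>i=1..p. \<Sum>j=1..i. \<Sum>k=1..i. z i j k)"
      by (simp add: E_def)
    also have "\<dots> = (\<Sum>i=1..p. \<Sum>j=1..i. e i * step a j)"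
      by (intro sum.cong refl zk)
    also have "\<dots> = (\<Sum>i=1..p. e i * a i)"
      by (intro sum.cong refl) (simp only: sum_distrib_left[symmetric] sum_step[OF mono])
    also have "\<dots> = card (cells Y)"
      by (rule card_cells[OF rows strict_mono_on_imp_inj_on[OF mono], symmetric])
    finally show "card E = card (cells Y)" .
  qed
qed

section \<open>From a Latin filling to an allocation\<close>

text \<open>
  The column sums and the value sums follow since a row of length $a_i$ has its columns and its
  values in the blocks $1, \dots, i$.  The last bound holds since distinct cells have distinct pairs
  (column, value).
\<close>

lemma allocation_if_latin:
  assumes mono: "strict_mono_on {1..p} a" and rows: "consists_of_rows Y p a e"
    and "latin Y"
  obtains z where "allocation p a e z"
proof -
  obtain \<sigma> where row: "bij_betw (\<lambda>x. (fst x, \<sigma> x)) (cells Y) (cells Y)"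
    and col: "inj_on (\<lambda>x. (snd x, \<sigma> x)) (cells Y)"
    using \<open>latin Y\<close> unfolding latin_iff by blast
  have inj: "inj_on a {1..p}" using mono by (rule strict_mono_on_imp_inj_on)
  define z where "z i j k =
    card {x \<in> cells Y. Y ! fst x = a i \<and> snd x \<in> block a j \<and> \<sigma> x \<in> block a k}" for i j k
  have card_snd: "card {x \<in> cells Y. Y ! fst x = a i \<and> snd x \<in> block a j} = e i * step a j"
    if "i \<in> {1..p}" "j \<in> {1..i}" for i j
  proof -
    have "{..<a i} \<inter> block a j = block a j" using block_subset[OF mono that] by blast
    then show ?thesis
      using rows that by (simp add: cells_of_length card_cartesian_product consists_of_rows_def)
  qed
  have card_\<sigma>: "card {x \<in> cells Y. Y ! fst x = a i \<and> \<sigma> x \<in> block a k} = e i * step a k"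
    if "i \<in> {1..p}" "k \<in> {1..i}" for i k
  proof -
    have "bij_betw (\<lambda>x. (fst x, \<sigma> x)) {x \<in> cells Y. Y ! fst x = a i \<and> \<sigma> x \<in> block a k}
        {x \<in> cells Y. Y ! fst x = a i \<and> snd x \<in> block a k}"
      using bij_betw_Collect[OF row, of "\<lambda>x. Y ! fst x = a i \<and> snd x \<in> block a k"] by simp
    with card_snd[OF that] show ?thesis by (simp add: bij_betw_same_card)
  qed
  have snd_less: "snd x < a i" and \<sigma>_less: "\<sigma> x < a i" if "x \<in> cells Y" "Y ! fst x = a i" for x i
    using that bij_betwE[OF row] by (fastforce simp: cells_def)+
  have "allocation p a e z"
    unfolding allocation_def
  proof (intro conjI ballI)
    fix i j assume ij: "i \<in> {1..p}" "j \<in> {1..i}"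
    have "(\<Sum>k=1..i. z i j k)
        = card {x \<in> {x \<in> cells Y. Y ! fst x = a i \<and> snd x \<in> block a j}. \<sigma> x < a i}"
      unfolding sum_card_block[OF mono ij(1) finite_subset[OF Collect_restrict finite_cells], symmetric]
      by (simp add: z_def)
    also have "\<dots> = card {x \<in> cells Y. Y ! fst x = a i \<and> snd x \<in> block a j}"
      using \<sigma>_less by (intro arg_cong[where f = card]) auto
    finally show "(\<Sum>k=1..i. z i j k) = e i * step a j" using card_snd[OF ij] by simp
  next
    fix i k assume ik: "i \<in> {1..p}" "k \<in> {1..i}"
    have "(\<Sum>j=1..i. z i j k)
        = card {x \<in> {x \<in> cells Y. Y ! fst x = a i \<and> \<sigma> x \<in> block a k}. snd x < a i}"
      unfolding sum_card_block[OF mono ik(1) finite_subset[OF Collect_restrict finite_cells], symmetric]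
      by (simp add: z_def conj_ac)
    also have "\<dots> = card {x \<in> cells Y. Y ! fst x = a i \<and> \<sigma> x \<in> block a k}"
      using snd_less by (intro arg_cong[where f = card]) auto
    finally show "(\<Sum>j=1..i. z i j k) = e i * step a k" using card_\<sigma>[OF ik] by simp
  next
    fix j k assume jk: "j \<in> {1..p}" "k \<in> {1..p}"
    let ?F = "\<lambda>i. {x \<in> cells Y. Y ! fst x = a i \<and> snd x \<in> block a j \<and> \<sigma> x \<in> block a k}"
    have "(\<Sum>i=max j k..p. z i j k) = card (\<Union>i\<in>{max j k..p}. ?F i)"
      unfolding z_def using inj_on_eq_iff[OF inj] jk
      by (intro card_UN_disjoint[symmetric]) auto
    also have "\<dots> \<le> card (block a j \<times> block a k)"
      by (rule card_inj_on_le[where f = "\<lambda>x. (snd x, \<sigma> x)"])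
        (auto intro: inj_on_subset[OF col])
    finally show "(\<Sum>i=max j k..p. z i j k) \<le> step a j * step a k"
      by (simp add: card_cartesian_product)
  qed
  then show ?thesis by (rule that)
qed

theorem theorem13:
  fixes p :: nat and a e :: "nat \<Rightarrow> nat" and Y :: "nat list"
  assumes "p \<ge> 1"
    and "0 < a 1"
    and "strict_mono_on {1..p} a"
    and "\<forall>i \<in> {1..p}. e i \<ge> 1"
    and "young_diagram Y"
    and "consists_of_rows Y p a e"
  shows "(\<exists>z. allocation p a e z) \<longleftrightarrow> latin Y"
  using latin_if_allocation[OF assms(3,6)] allocation_if_latin[OF assms(3,6)] by blast

end
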